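(* Let $R$ be a polyhedral function on $\mathbb R^m$ and let $\mathcal R:=\pi^{y,z}_{y}\big(\mathcal F_{\mathrm{low}}(\operatorname{epi}(R))\big)$, the coarsest polyhedral complex such that $R$ is affine on each of its elements. Let $A\in\mathbb R^{q\times m}$, $B\in\mathbb R^{q\times n}$, $b\in\mathbb R^q$ be fixed, and let $\boldsymbol c\in L^1(\Omega,\mathcal A,\mathbb P;\mathbb R^m)$ be an integrable random vector with $\boldsymbol c\in-\operatorname{Cone}(A^\top)$ almost surely. Define, for all $x\in\mathbb R^n$, $y\in\mathbb R^m$, $$Q(x,y):=R(y)+\mathbb I_{Ay+Bx\le b},\qquad V(x):=\mathbb E\Big[\min_{y\in\mathbb R^m}\boldsymbol c^\top y+Q(x,y)\Big].$$ Let $P:=\{(x,y)\in\mathbb R^n\times\mathbb R^m: Ay+Bx\le b\}$ and $\mathcal V:=\mathcal C\big(\mathcal F(P)\wedge(\mathbb R^n\times\mathcal R),\,\pi^{x,y}_x\big)$, a collection of polyhedra in $\mathbb R^n$. Then $\mathcal V\preceq\mathcal C(\operatorname{epi}(Q),\pi^{x,y,z}_x)$, and $V$ is a polyhedral function which is affine on each element of $\mathcal V$.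
   Context: A function with values in $\mathbb R\cup\{+\infty\}$ is polyhedral if its epigraph is a (possibly empty) polyhedron. $\mathbb I_{\mathtt p}$ equals $0$ if $\mathtt p$ is true and $+\infty$ otherwise. $\operatorname{Cone}(A^\top):=A^\top\mathbb R^q_+$. $\pi^{x,y}_x$, $\pi^{x,y,z}_x$, $\pi^{y,z}_y$ denote the coordinate projections $(x,y)\mapsto x$, $(x,y,z)\mapsto x$, $(y,z)\mapsto y$ with $x\in\mathbb R^n,y\in\mathbb R^m,z\in\mathbb R$; applied to a collection of sets, they act on each set. For a polyhedral function $f$ on $\mathbb R^d$ and $\psi\in\mathbb R^d$, $\operatorname{epi}(f)^{\psi,1}:=\arg\min_{(x,z)\in\operatorname{epi}(f)}\psi^\top x+z$, and $\mathcal F_{\mathrm{low}}(\operatorname{epi}(f)):=\{\operatorname{epi}(f)^{\psi,1}:\psi\in\mathbb R^d\}$ is the set of (non-empty) lower faces. A polyhedral complex is a finite collection $\mathcal C$ of polyhedra such that every non-empty face of an element is in $\mathcal C$ and the intersection of two elements is a (possibly empty) face of each; its support is the union of its elements. $\mathcal R'\preceq\mathcal C$ ($\mathcal R'$ refines $\mathcal C$) if they have the same support and every cell of $\mathcal R'$ is contained in a cell of $\mathcal C$. $\mathcal C\wedge\mathcal C':=\{C\cap C':C\in\mathcal C,C'\in\mathcal C'\}$. $\mathcal F(P)$ is the complex of non-empty faces of $P$ (including $P$), and $\mathbb R^n\times\mathcal R:=\{\mathbb R^n\times\sigma:\sigma\in\mathcal R\}$. Chamber complex: for a polyhedral complex $\mathcal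 P$ and a linear projection $\pi$, $\sigma_{\mathcal P,\pi}(x):=\bigcap_{F\in\mathcal P,\,x\in\pi(F)}\pi(F)$ for $x\in\pi(\operatorname{supp}\mathcal P)$, and $\mathcal C(\mathcal P,\pi):=\{\sigma_{\mathcal P,\pi}(x):x\in\pi(\operatorname{supp}\mathcal P)\}$. For a polyhedron $E$, $\mathcal C(E,\pi):=\mathcal C(\mathcal F(E),\pi)$.
   Formalization: The claims on V additionally assume that for each x the minimum over y is almost surely attained (possibly with value +∞); the cone condition on c does not imply this (R(y)=-2y, A=-1, B=0, b=0, c=1 gives V=-∞). The refinement claim needs no such assumption. *)

theory Defs
  imports "HOL-Probability.Probability"
begin

text \<open>Functions with values in the reals extended by plus infinity are rendered as functions into
  \<^typ>\<open>ereal\<close> that never take the value minus infinity.\<close>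

definition epi :: "('a \<Rightarrow> ereal) \<Rightarrow> ('a \<times> real) set" where
  "epi f = {(x, z). f x \<le> ereal z}"

definition polyhedral_fun :: "('a::euclidean_space \<Rightarrow> ereal) \<Rightarrow> bool" where
  "polyhedral_fun f \<longleftrightarrow> (\<forall>x. f x \<noteq> -\<infinity>) \<and> polyhedron (epi f)"

definition indicator_inf :: "bool \<Rightarrow> ereal" where
  "indicator_inf p = (if p then 0 else \<infinity>)"

definition Cone :: "real^'q^'m \<Rightarrow> (real^'m) set" where
  "Cone M = (\<lambda>u. M *v u) ` {u. 0 \<le> u}"

definition affine_fun_on :: "'a::euclidean_space set \<Rightarrow> ('a \<Rightarrow> ereal) \<Rightarrow> bool" where
  "affine_fun_on S f \<longleftrightarrow> (\<exists>a \<beta>. \<forall>x\<in>S. f x = ereal (a \<bullet> x + \<beta>))"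

definition faces :: "'a::euclidean_space set \<Rightarrow> 'a set set" where
  "faces P = {F. F face_of P \<and> F \<noteq> {}}"

definition lower_face :: "('a::euclidean_space \<times> real) set \<Rightarrow> 'a \<Rightarrow> ('a \<times> real) set" where
  "lower_face E \<psi> = {p. is_arg_min (\<lambda>(x, z). \<psi> \<bullet> x + z) (\<lambda>p. p \<in> E) p}"

definition lower_faces :: "('a::euclidean_space \<times> real) set \<Rightarrow> ('a \<times> real) set set" where
  "lower_faces E = range (lower_face E) - {{}}"

definition refines :: "'a set set \<Rightarrow> 'a set set \<Rightarrow> bool"  (infix "\<preceq>\<^sub>r" 50) where
  "\<R> \<preceq>\<^sub>r \<C> \<longleftrightarrow> \<Union>\<R> = \<Union>\<C> \<and> (\<forall>S\<in>\<R>. \<exists>C\<in>\<C>. S \<subseteq> C)"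

definition wedge :: "'a set set \<Rightarrow> 'a set set \<Rightarrow> 'a set set"  (infixl "\<and>\<^sub>r" 70) where
  "\<C> \<and>\<^sub>r \<C>' = {C \<inter> C' | C C'. C \<in> \<C> \<and> C' \<in> \<C>'}"

definition chamber :: "'a set set \<Rightarrow> ('a \<Rightarrow> 'b) \<Rightarrow> 'b \<Rightarrow> 'b set" where
  "chamber \<P> \<pi> x = \<Inter>{\<pi> ` F | F. F \<in> \<P> \<and> x \<in> \<pi> ` F}"

definition chamber_complex :: "'a set set \<Rightarrow> ('a \<Rightarrow> 'b) \<Rightarrow> 'b set set" where
  "chamber_complex \<P> \<pi> = chamber \<P> \<pi> ` (\<pi> ` \<Union>\<P>)"

text \<open>The expectation of an extended-real random variable is the difference of the expectations of
  its positive and negative parts. Here \<^const>\<open>e2ennreal\<close> truncates negative values to 0, and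
  \<infinity> - \<infinity> evaluates to \<infinity>.\<close>

definition ereal_expectation :: "'w measure \<Rightarrow> ('w \<Rightarrow> ereal) \<Rightarrow> ereal" where
  "ereal_expectation M X =
     enn2ereal (\<integral>\<^sup>+\<omega>. e2ennreal (X \<omega>) \<partial>M) - enn2ereal (\<integral>\<^sup>+\<omega>. e2ennreal (- X \<omega>) \<partial>M)"

lemma ereal_expectation_integrable:
  assumes "integrable M f"
  shows "ereal_expectation M (\<lambda>\<omega>. ereal (f \<omega>)) = ereal (integral\<^sup>L M f)"
proof -
  have fin: "(\<integral>\<^sup>+\<omega>. ennreal (f \<omega>) \<partial>M) \<noteq> \<infinity>" "(\<integral>\<^sup>+\<omega>. ennreal (- f \<omega>) \<partial>M) \<noteq> \<infinity>"
    using assms unfolding real_integrable_def by auto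
  have conv: "enn2ereal a = ereal (enn2real a)" if "a \<noteq> \<infinity>" for a
    using that by (cases a) (auto simp: enn2ereal_ennreal)
  show ?thesis
    unfolding ereal_expectation_def real_lebesgue_integral_def[OF assms]
    using conv[OF fin(1)] conv[OF fin(2)] by (simp add: e2ennreal_ereal)
qed

end

theory Submission
  imports Defs
begin

text \<open>
  The function \<open>Q\<close> is affine on each cell of the collection of intersections of a face of \<open>P\<close> with
  a cylinder over a cell of \<open>\<R>\<close>, and each point of its domain is relatively interior to some
  such cell. Everything else follows from these two facts, convexity of \<open>Q\<close> and linearity of the
  projection, so the argument is carried out for a convex function \<open>f\<close> with a subdivision of
  this kind (\<open>affine_subdivision\<close>) and a linear map \<open>\<pi>\<close>.

  The reason behind both claims is that a relatively interior point \<open>p\<close> of a cell is inner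
  to a segment of the cell starting at any other of its points. If a face of the epigraph contains
  a point above \<open>p\<close>, it therefore contains a point above each point of the cell, which gives the refinement
  (\<open>chamber_complex_refines_epi\<close>). If \<open>p\<close> minimizes a linear perturbation of \<open>f\<close> over its fiber, so
  does each point of the cell over its own fiber (\<open>fiber_optimal_cell\<close>). By definition, the
  chamber of a point \<open>x\<close> lies in the projection of each cell that meets the fiber of \<open>x\<close>, so
  for every cost vector with a minimizer over \<open>x\<close> the optimal value is affine on that chamber. As
  the chambers do not depend on the cost, this survives taking expectations.

  Integrability holds because the optimal value at \<open>x\<close> is almost surely a minimum over finitely
  many candidates that do not depend on the cost (\<open>fiber_min_integrable\<close>). The expected value is
  convex and affine on finitely many polyhedral chambers covering its domain, so its epigraph is
  a convex finite union of polyhedra, hence a polyhedron. That chambers are polyhedra rests on linear images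
  of polyhedra being polyhedra (\<open>polyhedron_linear_image\<close>).
\<close>

section \<open>Images, preimages and unions of polyhedra\<close>

lemma polyhedron_halfspaces:
  fixes S :: "'a::euclidean_space set"
  assumes "polyhedron S"
  obtains C where "finite C" "S = {x. \<forall>h\<in>C. fst h \<bullet> x \<le> snd h}"
proof -
  obtain F where F: "finite F" "S = \<Inter>F" "\<forall>h\<in>F. \<exists>a b. a \<noteq> 0 \<and> h = {x. a \<bullet> x \<le> b}"
    using assms unfolding polyhedron_def by blast
  then obtain a b where ab: "\<And>h. h \<in> F \<Longrightarrow> h = {x. a h \<bullet> x \<le> b h}"
    by metis
  have "S = (\<Inter>h\<in>F. h)" using F(2) by simp
  also have "\<dots> = (\<Inter>h\<in>F. {x. a h \<bullet> x \<le> b h})" by (rule INF_cong[OF refl ab])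
  also have "\<dots> = {x. \<forall>h\<in>(\<lambda>h. (a h, b h)) ` F. fst h \<bullet> x \<le> snd h}" by auto
  finally show thesis using F(1) by (intro that[of "(\<lambda>h. (a h, b h)) ` F"]) auto
qed

text \<open>For a limit \<open>l\<close> of points \<open>f x\<^sub>n\<close> of the image, take \<open>x\<^sub>n\<close> of minimal norm in its fiber over \<open>f x\<^sub>n\<close>. If a
  subsequence stays bounded, compactness gives a preimage of \<open>l\<close>. Otherwise the normalized
  \<open>x\<^sub>n\<close> accumulate at a unit vector \<open>d\<close> in the kernel of \<open>f\<close> which is a recession direction of \<open>S\<close>.
  Since \<open>S\<close> has only finitely many constraints, \<open>x\<^sub>n - d\<close> still satisfies all of them for
  large \<open>n\<close>; it lies in the same fiber and is shorter than \<open>x\<^sub>n\<close>, a contradiction.\<close>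

lemma closed_linear_image_polyhedron:
  fixes f :: "'a::euclidean_space \<Rightarrow> 'b::euclidean_space"
  assumes "linear f" and "polyhedron S"
  shows "closed (f ` S)"
proof -
  obtain C where C: "finite C" "S = {x. \<forall>h\<in>C. fst h \<bullet> x \<le> snd h}"
    by (rule polyhedron_halfspaces[OF assms(2)])
  have clS: "closed S"
    using assms(2) by (rule polyhedron_imp_closed)
  have cont: "continuous_on UNIV f"
    using assms(1) by (simp add: linear_continuous_on linear_conv_bounded_linear)
  have "l \<in> f ` S" if yS: "\<forall>n. y n \<in> f ` S" and yl: "y \<longlonglongrightarrow> l" for y l
  proof -
    have "\<exists>x. x \<in> S \<and> f x = y n \<and> (\<forall>x'\<in>S. f x' = y n \<longrightarrow> norm x \<le> norm x')" for n
    proof -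
      have "closed (S \<inter> f -` {y n})"
        using clS cont by (intro closed_Int closed_vimage) auto
      moreover have "S \<inter> f -` {y n} \<noteq> {}"
        using yS[rule_format, of n] by auto
      ultimately obtain x where "x \<in> S \<inter> f -` {y n}"
        "\<And>x'. x' \<in> S \<inter> f -` {y n} \<Longrightarrow> dist 0 x \<le> dist 0 x'"
        by (rule distance_attains_inf[where a = 0]) blast
      then show ?thesis by auto
    qed
    then obtain x where x: "\<And>n. x n \<in> S" "\<And>n. f (x n) = y n"
      and minimal: "\<And>n x'. x' \<in> S \<Longrightarrow> f x' = y n \<Longrightarrow> norm (x n) \<le> norm x'"
      by metis
    show ?thesis
    proof (cases "\<exists>K. \<forall>k. \<exists>n\<ge>k. norm (x n) \<le> K")
      case True
      then obtain K where "\<forall>k. \<exists>n\<ge>k. norm (x n) \<le> K" by blast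
      then have "infinite {n. norm (x n) \<le> K}"
        by (auto simp: infinite_nat_iff_unbounded_le)
      then obtain r :: "nat \<Rightarrow> nat" where r: "strict_mono r" "\<forall>n. norm (x (r n)) \<le> K"
        using infinite_enumerate by blast
      have "compact (S \<inter> cball 0 K)"
        using clS by (simp add: closed_Int_compact)
      moreover have "\<forall>n. (x \<circ> r) n \<in> S \<inter> cball 0 K"
        using x(1) r(2) by auto
      ultimately obtain p s where ps: "p \<in> S \<inter> cball 0 K" "strict_mono (s :: nat \<Rightarrow> nat)" "((x \<circ> r) \<circ> s) \<longlonglongrightarrow> p"
        unfolding compact_def by metis
      have "(\<lambda>n. f (((x \<circ> r) \<circ> s) n)) \<longlonglongrightarrow> f p"
        by (rule continuous_on_tendsto_compose[OF cont ps(3)]) auto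
      moreover have "(\<lambda>n. f (((x \<circ> r) \<circ> s) n)) \<longlonglongrightarrow> l"
        using LIMSEQ_subseq_LIMSEQ[OF LIMSEQ_subseq_LIMSEQ[OF yl r(1)] ps(2)]
        by (simp add: x(2) o_def)
      ultimately have "f p = l" by (rule LIMSEQ_unique)
      then show ?thesis using ps(1) by blast
    next
      case False
      have "filterlim (\<lambda>n. norm (x n)) at_top sequentially"
        unfolding filterlim_at_top_dense eventually_sequentially
        using False by (meson not_le)
      define u where "u n = x n /\<^sub>R norm (x n)" for n
      have "\<exists>d r. d \<in> cball 0 (1::real) \<and> strict_mono (r :: nat \<Rightarrow> nat) \<and> (u \<circ> r) \<longlonglongrightarrow> d"
      proof -
        have "u n \<in> cball 0 1" for n by (cases "x n = 0") (auto simp: u_def)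
        then have "\<forall>n. u n \<in> cball 0 1" by blast
        then show ?thesis
          using compact_cball[of "0::'a" 1] unfolding compact_def by metis
      qed
      then obtain d r where r: "strict_mono r" and ud: "(\<lambda>n. u (r n)) \<longlonglongrightarrow> d"
        by (auto simp: o_def)
      define N where "N n = norm (x (r n))" for n
      have N: "filterlim N at_top sequentially"
        unfolding N_def
        using filterlim_compose[OF \<open>filterlim (\<lambda>n. norm (x n)) at_top sequentially\<close> filterlim_subseq[OF r]]
        by (simp add: o_def)
      have Npos: "\<forall>\<^sub>F n in sequentially. N n > K" for K
        using N by (simp add: filterlim_at_top_dense)
      have xu: "\<forall>\<^sub>F n in sequentially. x (r n) = N n *\<^sub>R u (r n)"
        using Npos[of 0] by eventually_elim (auto simp: u_def N_def)
      have inv0: "(\<lambda>n. inverse (N n)) \<longlonglongrightarrow> 0"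
        using N by (rule tendsto_inverse_0_at_top)
      have norm_d: "norm d = 1"
      proof -
        have "(\<lambda>n. norm (u (r n))) \<longlonglongrightarrow> norm d" using ud by (rule tendsto_norm)
        moreover have "\<forall>\<^sub>F n in sequentially. norm (u (r n)) = 1"
          using Npos[of 0] by eventually_elim (auto simp: u_def N_def)
        then have "(\<lambda>n. norm (u (r n))) \<longlonglongrightarrow> 1" by (rule tendsto_eventually)
        ultimately show ?thesis by (rule LIMSEQ_unique)
      qed
      have fd: "f d = 0"
      proof -
        have "(\<lambda>n. f (u (r n))) \<longlonglongrightarrow> f d"
          by (rule continuous_on_tendsto_compose[OF cont ud]) auto
        moreover have "(\<lambda>n. inverse (N n) *\<^sub>R y (r n)) \<longlonglongrightarrow> 0 *\<^sub>R l"
          using inv0 LIMSEQ_subseq_LIMSEQ[OF yl r] by (intro tendsto_scaleR) (auto simp: o_def)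
        moreover have "f (u (r n)) = inverse (N n) *\<^sub>R y (r n)" for n
          using assms(1) by (simp add: u_def N_def linear_cmul x(2))
        ultimately show ?thesis using LIMSEQ_unique by fastforce
      qed
      have recession: "fst h \<bullet> d \<le> 0" if "h \<in> C" for h
      proof -
        have "(\<lambda>n. fst h \<bullet> u (r n)) \<longlonglongrightarrow> fst h \<bullet> d"
          using ud by (intro tendsto_intros)
        moreover have "(\<lambda>n. inverse (N n) * snd h) \<longlonglongrightarrow> 0 * snd h"
          using inv0 by (intro tendsto_intros)
        moreover have "fst h \<bullet> u (r n) \<le> inverse (N n) * snd h" for n
          using x(1)[of "r n"] that unfolding C(2) u_def N_def
          by (auto intro!: mult_left_mono)
        ultimately show ?thesis using LIMSEQ_le by fastforce
      qed
      have shift: "\<forall>\<^sub>F n in sequentially. fst h \<bullet> (x (r n) - d) \<le> snd h" if h: "h \<in> C" for h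
      \<comment> \<open>A constraint orthogonal to \<open>d\<close> is unaffected by the shift; along any other one, \<open>x (r n)\<close> has
        slack tending to infinity.\<close>
      proof (cases "fst h \<bullet> d = 0")
        case True
        then show ?thesis using x(1) h by (simp add: C(2) inner_diff_right)
      next
        case False
        define s where "s = fst h \<bullet> d"
        have s: "s < 0" using False recession[OF h] by (simp add: s_def)
        have "(\<lambda>n. fst h \<bullet> u (r n)) \<longlonglongrightarrow> s"
          unfolding s_def using ud by (intro tendsto_intros)
        then have "\<forall>\<^sub>F n in sequentially. fst h \<bullet> u (r n) < s / 2"
          using s by (intro order_tendstoD(2)) auto
        with xu Npos[of 0] Npos[of "(snd h + s) / (s / 2)"] show ?thesis
        proof eventually_elim
          case (elim n)
          have "fst h \<bullet> x (r n) = N n * (fst h \<bullet> u (r n))"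
            using elim(1) by simp
          also have "\<dots> \<le> N n * (s / 2)"
            using elim by (intro mult_left_mono) auto
          also have "\<dots> \<le> snd h + s"
            using elim(3) s by (simp add: field_simps)
          finally show ?case by (simp add: inner_diff_right s_def)
        qed
      qed
      then have "\<forall>\<^sub>F n in sequentially. \<forall>h\<in>C. fst h \<bullet> (x (r n) - d) \<le> snd h"
        using C(1) by (simp add: eventually_ball_finite)
      moreover have "\<forall>\<^sub>F n in sequentially. u (r n) \<bullet> d > 1/2"
      proof -
        have "(\<lambda>n. u (r n) \<bullet> d) \<longlonglongrightarrow> d \<bullet> d"
          using ud by (intro tendsto_intros)
        moreover have "d \<bullet> d = 1" using norm_d by (simp add: norm_eq_1)
        ultimately show ?thesis by (auto dest: order_tendstoD(1)[where a = "1/2"])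
      qed
      ultimately have "\<forall>\<^sub>F n in sequentially. False"
        using xu Npos[of 1]
      proof eventually_elim
        case (elim n)
        have "x (r n) - d \<in> S" using elim(1) by (simp add: C(2))
        moreover have "f (x (r n) - d) = y (r n)"
          using assms(1) fd by (simp add: linear_diff x(2))
        ultimately have "N n \<le> norm (x (r n) - d)"
          unfolding N_def by (rule minimal)
        then have "(N n)\<^sup>2 \<le> (norm (x (r n) - d))\<^sup>2"
          using elim(4) by (intro power_mono) auto
        also have "\<dots> = (N n)\<^sup>2 - 2 * (x (r n) \<bullet> d) + 1"
          using norm_d by (simp add: N_def power2_norm_eq_inner inner_diff_left inner_diff_right
            inner_commute norm_eq_1)
        finally have "2 * (x (r n) \<bullet> d) \<le> 1" by simp
        moreover have "x (r n) \<bullet> d = N n * (u (r n) \<bullet> d)"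
          using elim(3) by simp
        moreover have "1 * (1/2) < N n * (u (r n) \<bullet> d)"
          using elim by (intro mult_strict_mono) auto
        ultimately show ?case by simp
      qed
      then show ?thesis by simp
    qed
  qed
  then show ?thesis unfolding closed_sequential_limits by blast
qed

lemma face_of_linear_vimage:
  assumes "linear f" and "convex S" and "T face_of f ` S"
  shows "(S \<inter> f -` T) face_of S"
  unfolding face_of_def
proof (intro conjI ballI impI)
  have "convex T" using assms(3) by (rule face_of_imp_convex)
  then show "convex (S \<inter> f -` T)"
    using assms by (intro convex_Int convex_linear_vimage)
next
  fix p q x
  assume p: "p \<in> S" and q: "q \<in> S" and x: "x \<in> S \<inter> f -` T" and seg: "x \<in> open_segment p q"
  obtain t where t: "0 < t" "t < 1" "x = (1 - t) *\<^sub>R p + t *\<^sub>R q"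
    using seg by (auto simp: in_segment)
  then have fx: "f x = (1 - t) *\<^sub>R f p + t *\<^sub>R f q"
    using assms(1) by (simp add: linear_add linear_cmul)
  have "f p \<in> T \<and> f q \<in> T"
  proof (cases "f p = f q")
    case True
    then have "f x = f p" using fx by (simp flip: scaleR_add_left)
    then show ?thesis using True x by simp
  next
    case False
    then have "f x \<in> open_segment (f p) (f q)"
      using t fx by (auto simp: in_segment)
    then show ?thesis using face_ofD[OF assms(3)] p q x by blast
  qed
  then show "p \<in> S \<inter> f -` T" "q \<in> S \<inter> f -` T" using p q by auto
qed auto

text \<open>Polyhedra are the closed convex sets with finitely many faces, and a face of the image is
  the image of the face formed by its preimage.\<close>

lemma polyhedron_linear_image:
  fixes f :: "'a::euclidean_space \<Rightarrow> 'b::euclidean_space"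
  assumes "linear f" and "polyhedron S"
  shows "polyhedron (f ` S)"
proof -
  have S: "convex S" "finite {F. F face_of S}"
    using assms(2) by (auto simp: polyhedron_eq_finite_faces)
  have "T \<in> (`) f ` {F. F face_of S}" if "T face_of f ` S" for T
  proof -
    have "T = f ` (S \<inter> f -` T)"
      using face_of_imp_subset[OF that] by blast
    then show ?thesis
      using face_of_linear_vimage[OF assms(1) S(1) that] by blast
  qed
  then have "{T. T face_of f ` S} \<subseteq> (`) f ` {F. F face_of S}" by blast
  then have "finite {T. T face_of f ` S}"
    using finite_imageI[OF S(2)] by (rule finite_subset)
  then show ?thesis
    using closed_linear_image_polyhedron[OF assms] convex_linear_image[OF assms(1) S(1)]
    by (simp add: polyhedron_eq_finite_faces)
qed

text \<open>A face of the union meets each member in a face of that member, so there are only finitely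
  many candidates for a face of the union.\<close>

lemma polyhedron_convex_Union:
  fixes \<S> :: "'a::euclidean_space set set"
  assumes "finite \<S>" and "\<And>S. S \<in> \<S> \<Longrightarrow> polyhedron S" and "convex (\<Union>\<S>)"
  shows "polyhedron (\<Union>\<S>)"
proof -
  define \<F> where "\<F> = (\<Union>S\<in>\<S>. {F. F face_of S})"
  have "finite \<F>"
    unfolding \<F>_def using assms(1,2) by (intro finite_UN_I finite_polyhedron_faces) auto
  have "F \<in> Union ` Pow \<F>" if F: "F face_of \<Union>\<S>" for F
  proof -
    have "F \<inter> S face_of S" if "S \<in> \<S>" for S
    proof -
      have "F \<inter> S face_of \<Union>\<S> \<inter> S"
        using F face_of_refl[OF polyhedron_imp_convex[OF assms(2)[OF that]]] by (rule face_of_Int_Int)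
      moreover have "\<Union>\<S> \<inter> S = S" using that by blast
      ultimately show ?thesis by simp
    qed
    then have "(\<lambda>S. F \<inter> S) ` \<S> \<subseteq> \<F>" by (auto simp: \<F>_def)
    moreover have "F = \<Union>((\<lambda>S. F \<inter> S) ` \<S>)"
      using face_of_imp_subset[OF F] by blast
    ultimately show ?thesis by blast
  qed
  then have "{F. F face_of \<Union>\<S>} \<subseteq> Union ` Pow \<F>" by blast
  moreover have "finite (Union ` Pow \<F>)" using \<open>finite \<F>\<close> by simp
  ultimately have "finite {F. F face_of \<Union>\<S>}" by (rule finite_subset)
  moreover have "closed (\<Union>\<S>)"
    using assms(1,2) by (intro closed_Union) (auto intro: polyhedron_imp_closed)
  ultimately show ?thesis
    using assms(3) by (simp add: polyhedron_eq_finite_faces)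
qed

lemma polyhedron_linear_vimage:
  fixes f :: "'a::euclidean_space \<Rightarrow> 'b::euclidean_space"
  assumes "linear f" and "polyhedron S"
  shows "polyhedron (f -` S)"
proof -
  obtain C where C: "finite C" "S = {x. \<forall>h\<in>C. fst h \<bullet> x \<le> snd h}"
    by (rule polyhedron_halfspaces[OF assms(2)])
  have "f -` S = \<Inter>((\<lambda>h. {x. adjoint f (fst h) \<bullet> x \<le> snd h}) ` C)"
    by (auto simp: C(2) adjoint_clauses(2)[OF assms(1)])
  also have "polyhedron \<dots>"
    using C(1) by (intro polyhedron_Inter) (auto simp: polyhedron_halfspace_le)
  finally show ?thesis .
qed

text \<open>The smallest face containing \<open>p\<close>: if \<open>p\<close> were on its relative boundary, a supporting
  hyperplane at \<open>p\<close> would cut out a smaller one.\<close>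

lemma exists_face_rel_interior:
  fixes S :: "'a::euclidean_space set"
  assumes "convex S" and "p \<in> S"
  obtains F where "F face_of S" "p \<in> rel_interior F"
proof -
  define F where "F = \<Inter>{T. T face_of S \<and> p \<in> T}"
  have "S \<in> {T. T face_of S \<and> p \<in> T}"
    using assms by (simp add: face_of_refl)
  then have F: "F face_of S"
    unfolding F_def by (intro face_of_Inter) auto
  have pF: "p \<in> F" unfolding F_def by blast
  have cF: "convex F" using F by (rule face_of_imp_convex)
  have "p \<in> rel_interior F"
  proof (rule ccontr)
    assume "p \<notin> rel_interior F"
    then obtain a where a: "\<And>y. y \<in> F \<Longrightarrow> a \<bullet> p \<le> a \<bullet> y" "\<And>y. y \<in> rel_interior F \<Longrightarrow> a \<bullet> p < a \<bullet> y"
      using supporting_hyperplane_rel_boundary[OF cF pF] by metis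
    have "(F \<inter> {y. a \<bullet> y = a \<bullet> p}) face_of F"
      using cF a(1) by (rule face_of_Int_supporting_hyperplane_ge)
    then have "(F \<inter> {y. a \<bullet> y = a \<bullet> p}) face_of S"
      using F face_of_trans by blast
    then have "F \<subseteq> {y. a \<bullet> y = a \<bullet> p}"
      using pF unfolding F_def by blast
    moreover obtain y where "y \<in> rel_interior F"
      using rel_interior_eq_empty[OF cF] pF by blast
    ultimately show False
      using a(2) rel_interior_subset[of F] by fastforce
  qed
  with F that show thesis by blast
qed

section \<open>Subdivisions into cells on which a function is affine\<close>

text \<open>What the argument needs to know about a polyhedral complex on whose cells \<open>f\<close> is affine:
  closure under faces is replaced by the weaker requirement that each point of the domain
  is relatively interior to some cell.\<close>

definition affine_subdivision :: "'a::euclidean_space set set \<Rightarrow> ('a \<Rightarrow> ereal) \<Rightarrow> bool" where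
  "affine_subdivision \<P> f \<longleftrightarrow> finite \<P> \<and> (\<forall>G\<in>\<P>. polyhedron G \<and> affine_fun_on G f) \<and>
     \<Union>\<P> = {p. f p \<noteq> \<infinity>} \<and> (\<forall>p\<in>\<Union>\<P>. \<exists>G\<in>\<P>. p \<in> rel_interior G)"

lemma affine_subdivision_cell:
  assumes "affine_subdivision \<P> f" "G \<in> \<P>"
  obtains a \<beta> where "\<And>p. p \<in> G \<Longrightarrow> f p = ereal (a \<bullet> p + \<beta>)"
  using assms unfolding affine_subdivision_def affine_fun_on_def by metis

lemma affine_subdivision_finite_value:
  assumes "affine_subdivision \<P> f"
  shows "f p = \<infinity> \<or> (\<exists>r. f p = ereal r)"
proof (cases "f p = \<infinity>")
  case False
  then obtain G where "G \<in> \<P>" "p \<in> G"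
    using assms unfolding affine_subdivision_def by blast
  then show ?thesis using affine_subdivision_cell[OF assms] by metis
qed simp

lemma lower_faceE:
  assumes "F \<in> lower_faces E"
  obtains \<psi> m where "\<And>p. p \<in> E \<Longrightarrow> m \<le> (\<psi>, 1) \<bullet> p" "F = E \<inter> {p. (\<psi>, 1) \<bullet> p = m}" "F \<noteq> {}"
proof -
  obtain \<psi> where F: "F = lower_face E \<psi>" "F \<noteq> {}"
    using assms by (auto simp: lower_faces_def)
  then obtain p0 where p0: "p0 \<in> lower_face E \<psi>" by blast
  have eq: "(\<lambda>(x, z). \<psi> \<bullet> x + z) = (\<lambda>p. (\<psi>, 1) \<bullet> p)"
    by (auto simp: inner_prod_def)
  have min: "p0 \<in> E" "\<And>p. p \<in> E \<Longrightarrow> (\<psi>, 1) \<bullet> p0 \<le> (\<psi>, 1) \<bullet> p"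
    using p0 unfolding lower_face_def is_arg_min_def eq by (auto simp: not_less)
  have "(\<nexists>q. q \<in> E \<and> (\<psi>, 1) \<bullet> q < (\<psi>, 1) \<bullet> p) \<longleftrightarrow> (\<psi>, 1) \<bullet> p = (\<psi>, 1) \<bullet> p0"
    if "p \<in> E" for p
    using min that by (metis not_less order_antisym)
  then have "F = E \<inter> {p. (\<psi>, 1) \<bullet> p = (\<psi>, 1) \<bullet> p0}"
    unfolding F(1) lower_face_def is_arg_min_def eq by blast
  then show thesis using min(2) F(2) by (intro that)
qed

text \<open>The graph point over \<open>y\<close> is relatively interior to some face of the epigraph. Faces of
  polyhedra are exposed, and the normal \<open>(\<psi>, \<tau>)\<close> has \<open>\<tau> \<le> 0\<close> because the epigraph is unbounded
  upwards. In fact \<open>\<tau> < 0\<close>: a face with \<open>\<tau> = 0\<close> contains points above the graph point, hence, by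
  relative interiority, also points below the graph. Dividing by \<open>\<tau>\<close> exhibits the face as a lower face, and
  projections preserve relative interiors.\<close>

lemma affine_subdivision_lower_faces:
  fixes R :: "'a::euclidean_space \<Rightarrow> ereal"
  assumes "polyhedral_fun R"
  shows "affine_subdivision ((\<lambda>F. fst ` F) ` lower_faces (epi R)) R"
proof -
  have poly: "polyhedron (epi R)" and not_minf: "\<And>y. R y \<noteq> -\<infinity>"
    using assms by (auto simp: polyhedral_fun_def)
  have conv: "convex (epi R)" using poly by (rule polyhedron_imp_convex)
  have face: "F face_of epi R" if FL: "F \<in> lower_faces (epi R)" for F
  proof -
    obtain \<psi> m where "\<And>p. p \<in> epi R \<Longrightarrow> m \<le> (\<psi>, 1) \<bullet> p" "F = epi R \<inter> {p. (\<psi>, 1) \<bullet> p = m}"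
      by (rule lower_faceE[OF FL]) blast
    then show ?thesis using face_of_Int_supporting_hyperplane_ge[OF conv] by simp
  qed
  have "finite (lower_faces (epi R))"
    using face by (intro finite_subset[OF _ finite_polyhedron_faces[OF poly]]) blast
  moreover have "polyhedron (fst ` F)" if "F \<in> lower_faces (epi R)" for F
    using face_of_polyhedron_polyhedron[OF poly face[OF that]] linear_fst
    by (intro polyhedron_linear_image)
  moreover have aff: "affine_fun_on (fst ` F) R" if FL: "F \<in> lower_faces (epi R)" for F
  proof -
    obtain \<psi> m where F: "\<And>p. p \<in> epi R \<Longrightarrow> m \<le> (\<psi>, 1) \<bullet> p" "F = epi R \<inter> {p. (\<psi>, 1) \<bullet> p = m}"
      by (rule lower_faceE[OF FL]) blast
    have "R y = ereal (- \<psi> \<bullet> y + m)" if yz: "(y, z) \<in> F" for y z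
    proof -
      have "R y \<le> ereal z" using yz by (simp add: F(2) epi_def)
      then obtain r where r: "R y = ereal r" "r \<le> z"
        using not_minf[of y] by (cases "R y") auto
      then have "m \<le> (\<psi>, 1) \<bullet> (y, r)" by (intro F(1)) (simp add: epi_def)
      moreover have "(\<psi>, 1) \<bullet> (y, z) = m" using yz by (simp add: F(2))
      ultimately have "r = m - \<psi> \<bullet> y" using r(2) by simp
      then show ?thesis using r(1) by simp
    qed
    then have "\<forall>y\<in>fst ` F. R y = ereal (- \<psi> \<bullet> y + m)" by auto
    then show ?thesis unfolding affine_fun_on_def by blast
  qed
  moreover have cover: "\<exists>F\<in>lower_faces (epi R). y \<in> rel_interior (fst ` F)" if fin: "R y \<noteq> \<infinity>" for y
  proof -
    obtain r where r: "R y = ereal r" using fin not_minf[of y] by (cases "R y") auto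
    then have "(y, r) \<in> epi R" by (simp add: epi_def)
    then obtain F where F: "F face_of epi R" "(y, r) \<in> rel_interior F"
      using exists_face_rel_interior[OF conv] by blast
    have memF: "(y, r) \<in> F" using F(2) rel_interior_subset by blast
    have convF: "convex F" using F(1) by (rule face_of_imp_convex)
    obtain a b where a: "epi R \<subseteq> {p. a \<bullet> p \<le> b}" "F = epi R \<inter> {p. a \<bullet> p = b}"
      using F(1) exposed_face_of_polyhedron[OF poly, of F] unfolding exposed_face_of_def by blast
    obtain \<psi> \<tau> where \<psi>: "a = (\<psi>, \<tau>)" by (cases a)
    have eq: "\<psi> \<bullet> y + \<tau> * r = b" using memF a(2) \<psi> by simp
    have up: "(y, r + 1) \<in> epi R" using r by (simp add: epi_def)
    then have "\<psi> \<bullet> y + \<tau> * (r + 1) \<le> b" using a(1) \<psi> by auto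
    then have "\<tau> \<le> 0" using eq by (simp add: algebra_simps)
    moreover have "\<tau> \<noteq> 0"
    proof
      assume "\<tau> = 0"
      then have "(y, r + 1) \<in> F" using up eq \<psi> by (simp add: a(2))
      then obtain e where e: "e > 1" "(1 - e) *\<^sub>R (y, r + 1) + e *\<^sub>R (y, r) \<in> F"
        using F(2) convex_rel_interior_iff[OF convF] memF by blast
      moreover have "(1 - e) *\<^sub>R (y, r + 1) + e *\<^sub>R (y, r) = (y, r + 1 - e)"
        by (simp add: algebra_simps flip: scaleR_add_left)
      ultimately have "(y, r + 1 - e) \<in> epi R" by (simp add: a(2))
      then show False using r e(1) by (simp add: epi_def)
    qed
    ultimately have \<tau>: "\<tau> < 0" by simp
    define \<phi> where "\<phi> = \<psi> /\<^sub>R \<tau>"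
    have scale: "\<phi> \<bullet> x + z = (a \<bullet> (x, z)) / \<tau>" for x z
      using \<tau> by (simp add: \<phi>_def \<psi> field_simps)
    have "lower_face (epi R) \<phi> = F"
    proof -
      have lb: "b / \<tau> \<le> \<phi> \<bullet> x + z" if "(x, z) \<in> epi R" for x z
        using a(1) that \<tau> unfolding scale by (auto intro!: divide_right_mono_neg)
      have eqF: "(x, z) \<in> F \<longleftrightarrow> (x, z) \<in> epi R \<and> \<phi> \<bullet> x + z = b / \<tau>" for x z
        using \<tau> unfolding scale by (auto simp: a(2))
      have attained: "(y, r) \<in> epi R" "\<phi> \<bullet> y + r = b / \<tau>"
        using memF eqF by blast+
      show ?thesis
      proof (rule set_eqI)
        fix p :: "'a \<times> real"
        obtain x z where p: "p = (x, z)" by (cases p)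
        have "p \<in> lower_face (epi R) \<phi> \<longleftrightarrow>
            (x, z) \<in> epi R \<and> (\<forall>x' z'. (x', z') \<in> epi R \<longrightarrow> \<phi> \<bullet> x + z \<le> \<phi> \<bullet> x' + z')"
          by (auto simp: lower_face_def is_arg_min_def p not_less)
        also have "\<dots> \<longleftrightarrow> p \<in> F"
          unfolding p eqF using lb attained by (metis order_antisym)
        finally show "p \<in> lower_face (epi R) \<phi> \<longleftrightarrow> p \<in> F" .
      qed
    qed
    then have "F \<in> lower_faces (epi R)" using memF unfolding lower_faces_def by blast
    moreover have "y \<in> rel_interior (fst ` F)"
      using F(2) rel_interior_convex_linear_image[OF linear_fst convF] by force
    ultimately show ?thesis by blast
  qed
  moreover have "\<Union>((\<lambda>F. fst ` F) ` lower_faces (epi R)) = {y. R y \<noteq> \<infinity>}"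
  proof (intro equalityI subsetI)
    fix y assume "y \<in> \<Union>((\<lambda>F. fst ` F) ` lower_faces (epi R))"
    then show "y \<in> {y. R y \<noteq> \<infinity>}" using aff unfolding affine_fun_on_def by fastforce
  next
    fix y assume "y \<in> {y. R y \<noteq> \<infinity>}"
    then show "y \<in> \<Union>((\<lambda>F. fst ` F) ` lower_faces (epi R))"
      using cover[of y] rel_interior_subset by blast
  qed
  ultimately show ?thesis
    unfolding affine_subdivision_def by auto
qed

text \<open>A point of the domain is relatively interior to a face of \<open>P\<close> and to a cylinder over a cell,
  and then also to their intersection.\<close>

lemma affine_subdivision_constraint:
  fixes R :: "'b::euclidean_space \<Rightarrow> ereal" and P :: "('a::euclidean_space \<times> 'b) set"
  assumes R: "affine_subdivision \<R> R" and P: "polyhedron P"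
  shows "affine_subdivision (faces P \<and>\<^sub>r ((\<lambda>\<sigma>. UNIV \<times> \<sigma>) ` \<R>))
           (\<lambda>(x, y). R y + indicator_inf ((x, y) \<in> P))" (is "affine_subdivision ?\<P> ?Q")
  unfolding affine_subdivision_def
proof (intro conjI ballI)
  have wedge: "?\<P> = (\<Union>F\<in>faces P. (\<lambda>\<sigma>. F \<inter> UNIV \<times> \<sigma>) ` \<R>)"
    unfolding wedge_def by blast
  have faces: "finite (faces P)" "\<And>F. F \<in> faces P \<Longrightarrow> polyhedron F \<and> F \<subseteq> P"
    using finite_polyhedron_faces[OF P] face_of_polyhedron_polyhedron[OF P]
    by (auto simp: faces_def dest: face_of_imp_subset)
  have cells: "finite \<R>" "\<And>\<sigma>. \<sigma> \<in> \<R> \<Longrightarrow> polyhedron \<sigma>" "\<And>\<sigma>. \<sigma> \<in> \<R> \<Longrightarrow> affine_fun_on \<sigma> R"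
    "\<Union>\<R> = {y. R y \<noteq> \<infinity>}" "\<And>y. y \<in> \<Union>\<R> \<Longrightarrow> \<exists>\<sigma>\<in>\<R>. y \<in> rel_interior \<sigma>"
    using R by (auto simp: affine_subdivision_def)
  have cylinder: "polyhedron (UNIV \<times> \<sigma> :: ('a \<times> 'b) set)" if "\<sigma> \<in> \<R>" for \<sigma>
    using polyhedron_linear_vimage[OF linear_snd cells(2)[OF that]]
    by (simp add: vimage_snd)
  show "finite ?\<P>" using faces(1) cells(1) by (simp add: wedge)
  show "polyhedron G" if "G \<in> ?\<P>" for G
    using that faces(2) cylinder unfolding wedge by auto
  show "affine_fun_on G ?Q" if G: "G \<in> ?\<P>" for G
  proof -
    obtain F \<sigma> where F: "F \<in> faces P" "\<sigma> \<in> \<R>" "G = F \<inter> UNIV \<times> \<sigma>"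
      using G unfolding wedge by auto
    obtain a \<beta> where "\<forall>y\<in>\<sigma>. R y = ereal (a \<bullet> y + \<beta>)"
      using cells(3)[OF F(2)] unfolding affine_fun_on_def by blast
    then have "\<forall>p\<in>G. ?Q p = ereal ((0, a) \<bullet> p + \<beta>)"
      using faces(2)[OF F(1)] by (auto simp: F(3) indicator_inf_def)
    then show ?thesis unfolding affine_fun_on_def by blast
  qed
  have cover: "\<exists>G\<in>?\<P>. p \<in> rel_interior G" if p: "?Q p \<noteq> \<infinity>" for p
  proof -
    obtain x y where xy: "p = (x, y)" by (cases p)
    have "p \<in> P" "y \<in> \<Union>\<R>"
      using p by (auto simp: xy indicator_inf_def cells(4) split: if_splits)
    obtain F where F: "F face_of P" "p \<in> rel_interior F"
      using exists_face_rel_interior[OF polyhedron_imp_convex[OF P] \<open>p \<in> P\<close>] by blast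
    obtain \<sigma> where \<sigma>: "\<sigma> \<in> \<R>" "y \<in> rel_interior \<sigma>"
      using cells(5)[OF \<open>y \<in> \<Union>\<R>\<close>] by blast
    have cF: "convex F" using F(1) by (rule face_of_imp_convex)
    have c\<sigma>: "convex \<sigma>" using cells(2)[OF \<sigma>(1)] by (rule polyhedron_imp_convex)
    have "p \<in> rel_interior (UNIV \<times> \<sigma>)"
      using \<sigma>(2) rel_interior_Times[of "UNIV :: 'a set", OF convex_UNIV c\<sigma>] by (simp add: xy)
    then have "p \<in> rel_interior (F \<inter> UNIV \<times> \<sigma>)"
      using F(2) convex_rel_interior_inter_two[OF cF convex_Times[OF convex_UNIV c\<sigma>]] by blast
    moreover have "F \<in> faces P"
      using F rel_interior_subset[of F] by (auto simp: faces_def)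
    then have "F \<inter> UNIV \<times> \<sigma> \<in> ?\<P>"
      using \<sigma>(1) unfolding wedge by blast
    ultimately show ?thesis by blast
  qed
  show union: "\<Union>?\<P> = {p. ?Q p \<noteq> \<infinity>}"
  proof (intro equalityI subsetI)
    fix p assume "p \<in> \<Union>?\<P>"
    then show "p \<in> {p. ?Q p \<noteq> \<infinity>}"
      using faces(2) cells(4) unfolding wedge by (cases p) (auto simp: indicator_inf_def)
  next
    fix p assume "p \<in> {p. ?Q p \<noteq> \<infinity>}"
    then show "p \<in> \<Union>?\<P>" using cover[of p] rel_interior_subset by blast
  qed
  show "\<exists>G\<in>?\<P>. p \<in> rel_interior G" if "p \<in> \<Union>?\<P>" for p
    using that cover[of p] unfolding union by blast
qed

section \<open>Chamber complexes\<close>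

lemma chamber_subset: "F \<in> \<P> \<Longrightarrow> x \<in> \<pi> ` F \<Longrightarrow> chamber \<P> \<pi> x \<subseteq> \<pi> ` F"
  unfolding chamber_def by blast

lemma mem_chamber: "x \<in> chamber \<P> \<pi> x"
  unfolding chamber_def by blast

lemma Union_chamber_complex: "\<Union>(chamber_complex \<P> \<pi>) = \<pi> ` \<Union>\<P>"
proof (intro equalityI subsetI)
  fix y assume "y \<in> \<Union>(chamber_complex \<P> \<pi>)"
  then obtain x F where "F \<in> \<P>" "x \<in> \<pi> ` F" "y \<in> chamber \<P> \<pi> x"
    unfolding chamber_complex_def by blast
  then show "y \<in> \<pi> ` \<Union>\<P>" using chamber_subset[of F \<P> x \<pi>] by blast
next
  fix y assume "y \<in> \<pi> ` \<Union>\<P>"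
  then show "y \<in> \<Union>(chamber_complex \<P> \<pi>)"
    unfolding chamber_complex_def using mem_chamber[of y \<P> \<pi>] by blast
qed

lemma finite_chamber_complex:
  assumes "finite \<P>"
  shows "finite (chamber_complex \<P> \<pi>)"
proof -
  have "chamber_complex \<P> \<pi> \<subseteq> (\<lambda>\<F>. \<Inter>((\<lambda>F. \<pi> ` F) ` \<F>)) ` Pow \<P>"
  proof
    fix S assume "S \<in> chamber_complex \<P> \<pi>"
    then obtain x where "S = chamber \<P> \<pi> x"
      unfolding chamber_complex_def by blast
    also have "\<dots> = \<Inter>((\<lambda>F. \<pi> ` F) ` {F \<in> \<P>. x \<in> \<pi> ` F})"
      unfolding chamber_def by blast
    finally show "S \<in> (\<lambda>\<F>. \<Inter>((\<lambda>F. \<pi> ` F) ` \<F>)) ` Pow \<P>" by blast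
  qed
  then show ?thesis using assms by (auto intro: finite_subset)
qed

lemma polyhedron_chamber:
  fixes \<pi> :: "'a::euclidean_space \<Rightarrow> 'c::euclidean_space"
  assumes "finite \<P>" "\<And>F. F \<in> \<P> \<Longrightarrow> polyhedron F" "linear \<pi>"
  shows "polyhedron (chamber \<P> \<pi> x)"
proof -
  have "chamber \<P> \<pi> x = \<Inter>((\<lambda>F. \<pi> ` F) ` {F \<in> \<P>. x \<in> \<pi> ` F})"
    unfolding chamber_def by blast
  also have "polyhedron \<dots>"
    using assms by (intro polyhedron_Inter) (auto intro: polyhedron_linear_image)
  finally show ?thesis .
qed

text \<open>Solves for \<open>p\<close> when the segment from \<open>q\<close> to \<open>p\<close> is prolonged to a point \<open>m\<close>. Relative
  interiority of \<open>p\<close> in a cell is always used in this form: every point \<open>q\<close> of the cell is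
  the end of a segment in the cell that runs through \<open>p\<close>.\<close>

lemma line_extension_convex_combination:
  fixes p :: "'a::real_vector"
  assumes "e > 1" "m = (1 - e) *\<^sub>R q + e *\<^sub>R p"
  shows "p = (1 - 1/e) *\<^sub>R q + (1/e) *\<^sub>R m"
proof -
  have "(1 - 1/e) *\<^sub>R q + (1/e) *\<^sub>R m = ((1 - 1/e) + (1/e) * (1 - e)) *\<^sub>R q + ((1/e) * e) *\<^sub>R p"
    unfolding assms(2) by (simp only: scaleR_add_left scaleR_add_right scaleR_scaleR add.assoc)
  moreover have "(1 - 1/e) + (1/e) * (1 - e) = 0" "(1/e) * e = 1"
    using assms(1) by (simp_all add: field_simps)
  ultimately show ?thesis by simp
qed

text \<open>Suppose a face \<open>F\<close> of the epigraph contains \<open>(p, z)\<close> with \<open>\<pi> p = x\<close>, and let \<open>G\<close> be a cell with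
  \<open>p\<close> in its relative interior. Since \<open>f\<close> is affine on \<open>G\<close>, the graph over \<open>G\<close>, raised so that it
  passes through \<open>(p, z)\<close>, is a piece of the epigraph in which \<open>(p, z)\<close> is relatively interior, so
  it lies in \<open>F\<close>. Hence \<open>\<pi> ` G\<close> is contained in the projection of \<open>F\<close>, and each set in the
  intersection defining the coarser chamber contains one from the finer chamber.\<close>

lemma chamber_complex_refines_epi:
  fixes \<pi> :: "'a::euclidean_space \<Rightarrow> 'c"
  assumes sub: "affine_subdivision \<P> f" and conv: "convex (epi f)"
  shows "chamber_complex \<P> \<pi> \<preceq>\<^sub>r chamber_complex (faces (epi f)) (\<lambda>(p, z). \<pi> p)"
proof -
  let ?\<pi> = "\<lambda>(p, z::real). \<pi> p"
  have dom: "\<Union>\<P> = {p. f p \<noteq> \<infinity>}"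
    using sub by (simp add: affine_subdivision_def)
  have "\<Union>(faces (epi f)) = epi f"
    using face_of_refl[OF conv] by (auto simp: faces_def dest: face_of_imp_subset)
  moreover have "fst ` epi f = \<Union>\<P>"
  proof (intro equalityI subsetI)
    fix p assume "p \<in> fst ` epi f"
    then show "p \<in> \<Union>\<P>" by (auto simp: dom epi_def)
  next
    fix p assume "p \<in> \<Union>\<P>"
    then obtain r where "f p = ereal r"
      using affine_subdivision_finite_value[OF sub, of p] unfolding dom by auto
    then have "(p, r) \<in> epi f" by (simp add: epi_def)
    then show "p \<in> fst ` epi f" by force
  qed
  moreover have "?\<pi> ` E = \<pi> ` fst ` E" for E by force
  ultimately have supp: "?\<pi> ` \<Union>(faces (epi f)) = \<pi> ` \<Union>\<P>" by simp
  have "chamber \<P> \<pi> x \<subseteq> ?\<pi> ` F" if F: "F face_of epi f" and x: "x \<in> ?\<pi> ` F" for F x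
  proof -
    obtain p z where pz: "(p, z) \<in> F" "\<pi> p = x" using x by auto
    then have "(p, z) \<in> epi f" using face_of_imp_subset[OF F] by blast
    then have "f p \<le> ereal z" by (simp add: epi_def)
    then have "p \<in> \<Union>\<P>" by (auto simp: dom)
    then obtain G where G: "G \<in> \<P>" "p \<in> rel_interior G"
      using sub unfolding affine_subdivision_def by blast
    then have pG: "p \<in> G" using rel_interior_subset by blast
    have cG: "convex G" using sub G(1) by (auto simp: affine_subdivision_def polyhedron_imp_convex)
    obtain a \<beta> where a: "\<And>q. q \<in> G \<Longrightarrow> f q = ereal (a \<bullet> q + \<beta>)"
      using affine_subdivision_cell[OF sub G(1)] by blast
    define s where "s = z - (a \<bullet> p + \<beta>)"
    have s: "0 \<le> s" using \<open>f p \<le> ereal z\<close> a[OF pG] by (simp add: s_def)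
    have "q \<in> fst ` F" if q: "q \<in> G" for q
    proof (cases "q = p")
      case True
      then show ?thesis using pz(1) by force
    next
      case False
      obtain e where e: "e > 1" "(1 - e) *\<^sub>R q + e *\<^sub>R p \<in> G"
        using G(2) q convex_rel_interior_iff[OF cG] pG by blast
      define m where "m = (1 - e) *\<^sub>R q + e *\<^sub>R p"
      define t where "t = 1/e"
      have t: "0 < t" "t < 1" using e(1) by (auto simp: t_def)
      have p_eq: "p = (1 - t) *\<^sub>R q + t *\<^sub>R m"
        unfolding t_def using e(1) m_def by (rule line_extension_convex_combination)
      define lift where "lift v = (v, a \<bullet> v + \<beta> + s)" for v
      have in_epi: "lift v \<in> epi f" if "v \<in> G" for v
        using a[OF that] s by (simp add: lift_def epi_def)
      have "lift p = (1 - t) *\<^sub>R lift q + t *\<^sub>R lift m"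
        by (subst p_eq) (simp add: lift_def inner_add_right algebra_simps)
      moreover have "lift q \<noteq> lift m"
        using False p_eq by (auto simp: lift_def simp flip: scaleR_add_left)
      ultimately have "lift p \<in> open_segment (lift q) (lift m)"
        using t by (auto simp: in_segment)
      moreover have "lift p = (p, z)" by (simp add: lift_def s_def)
      ultimately have "lift q \<in> F"
        using face_ofD[OF F] in_epi[OF q] in_epi[OF e(2)] pz(1) m_def by metis
      then show ?thesis by (force simp: lift_def)
    qed
    then have "\<pi> ` G \<subseteq> ?\<pi> ` F" by force
    moreover have "chamber \<P> \<pi> x \<subseteq> \<pi> ` G"
      using G(1) pG pz(2) by (intro chamber_subset) auto
    ultimately show ?thesis by blast
  qed
  then have finer: "chamber \<P> \<pi> x \<subseteq> chamber (faces (epi f)) ?\<pi> x" for x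
    unfolding chamber_def[of "faces (epi f)"] by (intro Inter_greatest) (auto simp: faces_def)
  show ?thesis
    unfolding refines_def
  proof (intro conjI ballI)
    show "\<Union>(chamber_complex \<P> \<pi>) = \<Union>(chamber_complex (faces (epi f)) ?\<pi>)"
      unfolding Union_chamber_complex supp ..
    fix S assume "S \<in> chamber_complex \<P> \<pi>"
    then obtain x where "x \<in> \<pi> ` \<Union>\<P>" "S = chamber \<P> \<pi> x"
      unfolding chamber_complex_def by (rule imageE)
    then show "\<exists>C\<in>chamber_complex (faces (epi f)) ?\<pi>. S \<subseteq> C"
      using finer[of x] unfolding chamber_complex_def supp
      by (intro bexI[of _ "chamber (faces (epi f)) ?\<pi> x"]) auto
  qed
qed

section \<open>Minimization over the fibers of a linear map\<close>

definition fiber_min :: "('a::euclidean_space \<Rightarrow> ereal) \<Rightarrow> ('a \<Rightarrow> 'c) \<Rightarrow> 'a \<Rightarrow> 'c \<Rightarrow> ereal" where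
  "fiber_min f \<pi> w x = (INF p\<in>{p. \<pi> p = x}. ereal (w \<bullet> p) + f p)"

text \<open>Minimizers within their own fiber, the right-hand side of the constraint being read off
  from the point itself. This lets optimality of points in different fibers be compared.\<close>

definition fiber_optimal :: "('a::euclidean_space \<Rightarrow> ereal) \<Rightarrow> ('a \<Rightarrow> 'c) \<Rightarrow> 'a \<Rightarrow> 'a \<Rightarrow> bool" where
  "fiber_optimal f \<pi> w p \<longleftrightarrow>
     (\<forall>q. \<pi> q = \<pi> p \<longrightarrow> ereal (w \<bullet> p) + f p \<le> ereal (w \<bullet> q) + f q)"

lemma fiber_min_le: "fiber_min f \<pi> w (\<pi> p) \<le> ereal (w \<bullet> p) + f p"
  unfolding fiber_min_def by (intro INF_lower) simp

lemma fiber_min_optimal: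
  assumes "fiber_optimal f \<pi> w p"
  shows "fiber_min f \<pi> w (\<pi> p) = ereal (w \<bullet> p) + f p"
proof (rule order_antisym[OF fiber_min_le])
  show "ereal (w \<bullet> p) + f p \<le> fiber_min f \<pi> w (\<pi> p)"
    using assms unfolding fiber_min_def fiber_optimal_def by (intro INF_greatest) auto
qed

lemma epi_convex_combination:
  fixes f :: "'a::euclidean_space \<Rightarrow> ereal"
  assumes "convex (epi f)" "f p \<le> ereal r" "f q \<le> ereal s" "0 \<le> t" "t \<le> 1"
  shows "f ((1 - t) *\<^sub>R p + t *\<^sub>R q) \<le> ereal ((1 - t) * r + t * s)"
proof -
  have "(1 - t) *\<^sub>R (p, r) + t *\<^sub>R (q, s) \<in> epi f"
    using assms by (intro convexD) (auto simp: epi_def)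
  then show ?thesis by (simp add: epi_def)
qed

text \<open>Optimality spreads from one relatively interior point \<open>p\<close> to the whole cell, without
  appeal to duality. Let \<open>q'\<close> be a competitor of \<open>q\<close> in its fiber, and let \<open>m\<close> prolong the segment
  from \<open>q\<close> through \<open>p\<close>. Replacing \<open>q\<close> by \<open>q'\<close> in the convex combination of \<open>q\<close> and \<open>m\<close> that equals
  \<open>p\<close> gives a competitor \<open>p'\<close> of \<open>p\<close>. The objective is affine on the segment from \<open>q\<close> to \<open>m\<close> and convex from
  \<open>q'\<close> to \<open>m\<close>, so \<open>q'\<close> cannot beat \<open>q\<close>, or else \<open>p'\<close> would beat \<open>p\<close>.\<close>

lemma fiber_optimal_cell:
  fixes \<pi> :: "'a::euclidean_space \<Rightarrow> 'c::real_vector"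
  assumes sub: "affine_subdivision \<P> f" and conv: "convex (epi f)" and lin: "linear \<pi>"
    and G: "G \<in> \<P>" and p: "p \<in> rel_interior G" and opt: "fiber_optimal f \<pi> w p" and q: "q \<in> G"
  shows "fiber_optimal f \<pi> w q"
  unfolding fiber_optimal_def
proof (intro allI impI)
  fix q' assume q': "\<pi> q' = \<pi> q"
  have pG: "p \<in> G" using p rel_interior_subset by blast
  have cG: "convex G" using sub G by (auto simp: affine_subdivision_def polyhedron_imp_convex)
  obtain a \<beta> where a: "\<And>v. v \<in> G \<Longrightarrow> f v = ereal (a \<bullet> v + \<beta>)"
    using affine_subdivision_cell[OF sub G] by blast
  show "ereal (w \<bullet> q) + f q \<le> ereal (w \<bullet> q') + f q'"
  proof (cases "f q' = \<infinity>")
    case False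
    then obtain r where r: "f q' = ereal r"
      using affine_subdivision_finite_value[OF sub] by blast
    obtain e where e: "e > 1" "(1 - e) *\<^sub>R q + e *\<^sub>R p \<in> G"
      using p q convex_rel_interior_iff[OF cG] pG by blast
    define m where "m = (1 - e) *\<^sub>R q + e *\<^sub>R p"
    define t where "t = 1/e"
    have t: "0 < t" "t < 1" using e(1) by (auto simp: t_def)
    have p_eq: "p = (1 - t) *\<^sub>R q + t *\<^sub>R m"
      unfolding t_def using e(1) m_def by (rule line_extension_convex_combination)
    define p' where "p' = (1 - t) *\<^sub>R q' + t *\<^sub>R m"
    have "\<pi> p' = \<pi> p"
      unfolding p'_def p_eq using lin q' by (simp add: linear_add linear_cmul)
    then have "ereal (w \<bullet> p) + f p \<le> ereal (w \<bullet> p') + f p'"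
      using opt by (auto simp: fiber_optimal_def)
    also have "\<dots> \<le> ereal (w \<bullet> p') + ereal ((1 - t) * r + t * (a \<bullet> m + \<beta>))"
      unfolding p'_def using t r a[OF e(2)[folded m_def]]
      by (intro add_left_mono epi_convex_combination[OF conv]) auto
    finally have "w \<bullet> p + (a \<bullet> p + \<beta>) \<le> w \<bullet> p' + ((1 - t) * r + t * (a \<bullet> m + \<beta>))"
      by (simp add: a[OF pG])
    then have "(1 - t) * (w \<bullet> q + (a \<bullet> q + \<beta>)) \<le> (1 - t) * (w \<bullet> q' + r)"
      unfolding p'_def by (subst (asm) (1 2) p_eq) (simp add: inner_add_right algebra_simps)
    then show ?thesis using t by (simp add: a[OF q] r)
  qed simp
qed

text \<open>A cell with a minimizer over \<open>x\<close> in its relative interior. It may depend on \<open>w\<close>, but it comes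
  from a finite set and contains a minimizer over each point of \<open>\<pi> ` G\<close>, so in particular over each point of the
  chamber of \<open>x\<close>.\<close>

lemma exists_optimal_cell:
  fixes \<pi> :: "'a::euclidean_space \<Rightarrow> 'c::real_vector"
  assumes sub: "affine_subdivision \<P> f" and conv: "convex (epi f)" and lin: "linear \<pi>"
    and x: "x \<in> \<pi> ` \<Union>\<P>" and att: "\<exists>p. \<pi> p = x \<and> fiber_optimal f \<pi> w p"
  obtains G where "G \<in> \<P>" "x \<in> \<pi> ` G" "\<And>q. q \<in> G \<Longrightarrow> fiber_min f \<pi> w (\<pi> q) = ereal (w \<bullet> q) + f q"
proof -
  have dom: "\<Union>\<P> = {p. f p \<noteq> \<infinity>}"
    using sub by (simp add: affine_subdivision_def)
  obtain p where p: "\<pi> p = x" "fiber_optimal f \<pi> w p" using att by blast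
  obtain q where q: "\<pi> q = x" "f q \<noteq> \<infinity>" using x unfolding dom by blast
  have "ereal (w \<bullet> p) + f p \<le> ereal (w \<bullet> q) + f q"
    using p q(1) by (simp add: fiber_optimal_def)
  then have "p \<in> \<Union>\<P>" using q(2) by (auto simp: dom)
  then obtain G where G: "G \<in> \<P>" "p \<in> rel_interior G"
    using sub unfolding affine_subdivision_def by blast
  then have "x \<in> \<pi> ` G" using p(1) rel_interior_subset by blast
  then show thesis
    by (intro that[OF G(1)] fiber_min_optimal fiber_optimal_cell[OF sub conv lin G p(2)])
qed

text \<open>The chamber of \<open>x0\<close> is contained in \<open>\<pi> ` G\<close> for the optimal cell \<open>G\<close> at \<open>x0\<close>, and on \<open>G\<close> the
  minimum is given by an affine function. The existence of minimizers is required over \<open>x0\<close>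
  only; for random \<open>w\<close> this leaves a single exceptional null set for the whole chamber.\<close>

lemma fiber_min_affine_on_chamber:
  fixes \<pi> :: "'a::euclidean_space \<Rightarrow> 'c::real_vector"
  assumes sub: "affine_subdivision \<P> f" and conv: "convex (epi f)" and lin: "linear \<pi>"
    and x0: "x0 \<in> \<pi> ` \<Union>\<P>" and att: "\<exists>p. \<pi> p = x0 \<and> fiber_optimal f \<pi> w p"
    and x: "x \<in> chamber \<P> \<pi> x0" "fiber_min f \<pi> w x = ereal r"
    and y: "y \<in> chamber \<P> \<pi> x0" "fiber_min f \<pi> w y = ereal s"
    and t: "0 \<le> t" "t \<le> 1"
  shows "fiber_min f \<pi> w ((1 - t) *\<^sub>R x + t *\<^sub>R y) = ereal ((1 - t) * r + t * s)"
proof -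
  obtain G where G: "G \<in> \<P>" "x0 \<in> \<pi> ` G"
    and opt: "\<And>q. q \<in> G \<Longrightarrow> fiber_min f \<pi> w (\<pi> q) = ereal (w \<bullet> q) + f q"
    by (rule exists_optimal_cell[OF sub conv lin x0 att]) blast
  obtain a \<beta> where a: "\<And>p. p \<in> G \<Longrightarrow> f p = ereal (a \<bullet> p + \<beta>)"
    using affine_subdivision_cell[OF sub G(1)] by blast
  obtain p q where p: "p \<in> G" "\<pi> p = x" and q: "q \<in> G" "\<pi> q = y"
    using chamber_subset[OF G] x(1) y(1) by blast
  define m where "m = (1 - t) *\<^sub>R p + t *\<^sub>R q"
  have "convex G" using sub G(1) by (auto simp: affine_subdivision_def polyhedron_imp_convex)
  then have m: "m \<in> G" unfolding m_def using p(1) q(1) t by (intro convexD) auto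
  have "\<pi> m = (1 - t) *\<^sub>R x + t *\<^sub>R y"
    unfolding m_def using lin p q by (simp add: linear_add linear_cmul)
  moreover have "r = w \<bullet> p + (a \<bullet> p + \<beta>)" "s = w \<bullet> q + (a \<bullet> q + \<beta>)"
    using opt[OF p(1)] opt[OF q(1)] x(2) y(2) p q a by auto
  then have "w \<bullet> m + (a \<bullet> m + \<beta>) = (1 - t) * r + t * s"
    unfolding m_def by (simp add: inner_add_right algebra_simps)
  ultimately show ?thesis using opt[OF m] a[OF m] by simp
qed

lemma fiber_min_convex_combination:
  fixes \<pi> :: "'a::euclidean_space \<Rightarrow> 'c::real_vector"
  assumes conv: "convex (epi f)" and lin: "linear \<pi>"
    and x: "\<exists>p. \<pi> p = x \<and> fiber_optimal f \<pi> w p" "fiber_min f \<pi> w x = ereal r"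
    and y: "\<exists>p. \<pi> p = y \<and> fiber_optimal f \<pi> w p" "fiber_min f \<pi> w y = ereal s"
    and t: "0 \<le> t" "t \<le> 1"
  shows "fiber_min f \<pi> w ((1 - t) *\<^sub>R x + t *\<^sub>R y) \<le> ereal ((1 - t) * r + t * s)"
proof -
  obtain p q where p: "\<pi> p = x" "fiber_optimal f \<pi> w p" and q: "\<pi> q = y" "fiber_optimal f \<pi> w q"
    using x(1) y(1) by blast
  have "ereal (w \<bullet> p) + f p = ereal r" "ereal (w \<bullet> q) + f q = ereal s"
    using fiber_min_optimal[OF p(2)] fiber_min_optimal[OF q(2)] x(2) y(2) p(1) q(1) by auto
  then have "f p = ereal (r - w \<bullet> p)" "f q = ereal (s - w \<bullet> q)"
    by (cases "f p"; cases "f q"; auto)+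
  then have "f ((1 - t) *\<^sub>R p + t *\<^sub>R q) \<le> ereal ((1 - t) * (r - w \<bullet> p) + t * (s - w \<bullet> q))"
    using t by (intro epi_convex_combination[OF conv]) auto
  then have "ereal (w \<bullet> ((1 - t) *\<^sub>R p + t *\<^sub>R q)) + f ((1 - t) *\<^sub>R p + t *\<^sub>R q) \<le>
      ereal (w \<bullet> ((1 - t) *\<^sub>R p + t *\<^sub>R q)) + ereal ((1 - t) * (r - w \<bullet> p) + t * (s - w \<bullet> q))"
    by (rule add_left_mono)
  also have "\<dots> = ereal ((1 - t) * r + t * s)"
    by (simp add: inner_add_right algebra_simps)
  finally show ?thesis
    using fiber_min_le[of f \<pi> w "(1 - t) *\<^sub>R p + t *\<^sub>R q"] lin p(1) q(1)
    by (simp add: linear_add linear_cmul)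
qed

section \<open>The expected minimum\<close>

text \<open>The graph, translated to contain the origin, is a convex set \<open>D\<close>, so the vectors of \<open>span D\<close> are
  multiples of differences of two elements of \<open>D\<close>. Hence no nonzero vector of \<open>span D\<close> is vertical,
  and \<open>span D\<close> is the graph of a linear function.\<close>

lemma affine_extension:
  fixes g :: "'a::euclidean_space \<Rightarrow> real"
  assumes conv: "convex S"
    and g: "\<And>x y t. x \<in> S \<Longrightarrow> y \<in> S \<Longrightarrow> 0 \<le> t \<Longrightarrow> t \<le> 1 \<Longrightarrow>
      g ((1 - t) *\<^sub>R x + t *\<^sub>R y) = (1 - t) * g x + t * g y"
  obtains a \<beta> where "\<And>x. x \<in> S \<Longrightarrow> g x = a \<bullet> x + \<beta>"
proof (cases "S = {}")
  case True
  then show thesis using that by blast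
next
  case False
  then obtain x0 where x0: "x0 \<in> S" by blast
  define D where "D = (\<lambda>x. (x - x0, g x - g x0)) ` S"
  have D_comb: "(1 - t) *\<^sub>R u + t *\<^sub>R v \<in> D" if uv: "u \<in> D" "v \<in> D" and t: "0 \<le> t" "t \<le> 1" for u v t
  proof -
    obtain x y where xy: "x \<in> S" "y \<in> S" "u = (x - x0, g x - g x0)" "v = (y - x0, g y - g x0)"
      using uv unfolding D_def by blast
    have "(1 - t) *\<^sub>R x + t *\<^sub>R y \<in> S"
      using conv xy(1,2) t by (intro convexD) auto
    moreover have "(1 - t) *\<^sub>R u + t *\<^sub>R v =
        ((1 - t) *\<^sub>R x + t *\<^sub>R y - x0, g ((1 - t) *\<^sub>R x + t *\<^sub>R y) - g x0)"
      unfolding g[OF xy(1,2) t] xy(3,4) by (simp add: algebra_simps)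
    ultimately show ?thesis unfolding D_def by blast
  qed
  have D0: "0 \<in> D" unfolding D_def using x0 by (auto simp: zero_prod_def intro!: rev_image_eqI)
  define T where "T = {s *\<^sub>R (u - v) | s u v. 0 \<le> s \<and> u \<in> D \<and> v \<in> D}"
  have "subspace T"
    unfolding subspace_def
  proof (intro conjI ballI allI)
    have "0 *\<^sub>R (0 - 0) \<in> T" unfolding T_def using D0 by blast
    then show "0 \<in> T" by simp
  next
    fix d e assume "d \<in> T" "e \<in> T"
    then obtain s u v t u' v' where st: "0 \<le> s" "u \<in> D" "v \<in> D" "d = s *\<^sub>R (u - v)"
        "0 \<le> t" "u' \<in> D" "v' \<in> D" "e = t *\<^sub>R (u' - v')"
      unfolding T_def by blast
    show "d + e \<in> T"
    proof (cases "s + t = 0")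
      case True
      then have "s = 0" "t = 0" using st by auto
      then show ?thesis using \<open>d \<in> T\<close> st by simp
    next
      case False
      then have pos: "0 < s + t" using st by simp
      define c where "c = t / (s + t)"
      have c: "0 \<le> c" "c \<le> 1" "(s + t) * c = t" "(s + t) * (1 - c) = s"
        using pos st(1,5) by (auto simp: c_def field_simps)
      have "(s + t) *\<^sub>R (((1 - c) *\<^sub>R u + c *\<^sub>R u') - ((1 - c) *\<^sub>R v + c *\<^sub>R v')) =
          ((s + t) * (1 - c)) *\<^sub>R (u - v) + ((s + t) * c) *\<^sub>R (u' - v')"
        by (simp only: scaleR_diff_right scaleR_add_right scaleR_scaleR) simp
      also have "\<dots> = d + e" unfolding c st by simp
      finally show ?thesis
        unfolding T_def using D_comb[OF st(2,6) c(1,2)] D_comb[OF st(3,7) c(1,2)] pos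
        by (smt (verit, best) mem_Collect_eq)
    qed
  next
    fix c d assume "d \<in> T"
    then obtain s u v where s: "0 \<le> s" "u \<in> D" "v \<in> D" "d = s *\<^sub>R (u - v)"
      unfolding T_def by blast
    show "c *\<^sub>R d \<in> T"
    proof (cases "0 \<le> c")
      case True
      then have "c *\<^sub>R d = (c * s) *\<^sub>R (u - v)" "0 \<le> c * s" using s by auto
      then show ?thesis unfolding T_def using s by blast
    next
      case False
      then have "0 \<le> - c * s" using s(1) by (intro mult_nonneg_nonneg) auto
      moreover have "c *\<^sub>R d = (- c * s) *\<^sub>R (v - u)"
        unfolding s(4) by (simp add: algebra_simps)
      ultimately show ?thesis unfolding T_def using s by blast
    qed
  qed
  moreover have "D \<subseteq> T"
  proof
    fix u assume "u \<in> D"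
    then have "1 *\<^sub>R (u - 0) \<in> T" unfolding T_def using D0 zero_le_one by blast
    then show "u \<in> T" by simp
  qed
  ultimately have "span D \<subseteq> T" by (rule span_minimal[rotated])
  have kernel: "d = 0" if d: "d \<in> span D" "fst d = 0" for d
  proof -
    obtain s x y where "d = s *\<^sub>R ((x - x0, g x - g x0) - (y - x0, g y - g x0))"
      using d(1) \<open>span D \<subseteq> T\<close> unfolding T_def D_def by blast
    then show ?thesis using d(2) by (cases "s = 0") (auto simp: zero_prod_def)
  qed
  have "inj_on fst (span D)"
  proof (rule inj_onI)
    fix d e assume "d \<in> span D" "e \<in> span D" "fst d = fst e"
    then show "d = e" using kernel[of "d - e"] by (simp add: span_diff)
  qed
  then obtain L where L: "linear L" "\<forall>d\<in>span D. L (fst d) = d"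
    using linear_inj_on_left_inverse[OF linear_fst] by blast
  define h where "h v = snd (L v)" for v
  have h: "linear h"
    unfolding h_def using linear_compose[OF L(1) linear_snd] by (simp add: o_def)
  define a where "a = adjoint h 1"
  have ha: "h v = a \<bullet> v" for v
    using adjoint_works[OF h, of v 1] by (simp add: a_def inner_commute)
  have "g x = a \<bullet> x + (g x0 - a \<bullet> x0)" if "x \<in> S" for x
  proof -
    have "(x - x0, g x - g x0) \<in> span D"
      using that by (intro span_base) (auto simp: D_def)
    then have "L (x - x0) = (x - x0, g x - g x0)" using L(2) by fastforce
    then have "h (x - x0) = g x - g x0" by (simp add: h_def)
    then show ?thesis unfolding ha by (simp add: inner_diff_right)
  qed
  then show thesis by (rule that)
qed

text \<open>The epigraph is the union of the epigraphs of the affine pieces, and these are polyhedra.\<close>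

lemma polyhedral_fun_glue:
  fixes V :: "'a::euclidean_space \<Rightarrow> ereal"
  assumes "finite \<V>" and "\<And>\<sigma>. \<sigma> \<in> \<V> \<Longrightarrow> polyhedron \<sigma>" and aff: "\<And>\<sigma>. \<sigma> \<in> \<V> \<Longrightarrow> affine_fun_on \<sigma> V"
    and outside: "\<And>x. x \<notin> \<Union>\<V> \<Longrightarrow> V x = \<infinity>" and conv: "convex (epi V)"
  shows "polyhedral_fun V"
proof -
  define E where "E \<sigma> = epi V \<inter> fst -` \<sigma>" for \<sigma>
  have "polyhedron (E \<sigma>)" if \<sigma>: "\<sigma> \<in> \<V>" for \<sigma>
  proof -
    obtain a \<beta> where a: "\<forall>x\<in>\<sigma>. V x = ereal (a \<bullet> x + \<beta>)"
      using aff[OF \<sigma>] unfolding affine_fun_on_def by blast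
    have "E \<sigma> = fst -` \<sigma> \<inter> {p. (a, - 1) \<bullet> p \<le> - \<beta>}"
      unfolding E_def epi_def using a by auto
    moreover have "polyhedron (fst -` \<sigma> :: ('a \<times> real) set)"
      using linear_fst assms(2)[OF \<sigma>] by (rule polyhedron_linear_vimage)
    ultimately show ?thesis
      by (simp only: polyhedron_Int polyhedron_halfspace_le)
  qed
  moreover have "epi V = \<Union>(E ` \<V>)"
  proof -
    have "x \<in> \<Union>\<V>" if "(x, z) \<in> epi V" for x z
      using outside[of x] that by (cases "x \<in> \<Union>\<V>") (simp_all add: epi_def)
    then have "fst p \<in> \<Union>\<V>" if "p \<in> epi V" for p
      using that by (metis prod.collapse)
    then show ?thesis unfolding E_def by blast
  qed
  ultimately have "polyhedron (epi V)"
    using assms(1) conv by (auto intro!: polyhedron_convex_Union)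
  moreover have "V x \<noteq> -\<infinity>" for x
  proof (cases "x \<in> \<Union>\<V>")
    case True
    then show ?thesis using aff unfolding affine_fun_on_def by (metis UnionE MInfty_neq_ereal(1))
  qed (simp add: outside)
  ultimately show ?thesis by (simp add: polyhedral_fun_def)
qed

text \<open>Whichever cell is optimal, any of its points over \<open>x\<close> is a minimizer. So one point over \<open>x\<close>
  in each cell suffices as a set of candidates, for all \<open>\<omega>\<close> at once, and the minimum is that of finitely
  many integrable functions. It equals such a function almost everywhere but need not be
  measurable itself, hence the form of the conclusion.\<close>

lemma fiber_min_integrable:
  fixes \<pi> :: "'a::euclidean_space \<Rightarrow> 'c::real_vector"
  assumes sub: "affine_subdivision \<P> f" and conv: "convex (epi f)" and lin: "linear \<pi>"
    and M: "prob_space M" and W: "integrable M W" and x: "x \<in> \<pi> ` \<Union>\<P>"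
    and att: "AE \<omega> in M. \<exists>p. \<pi> p = x \<and> fiber_optimal f \<pi> (W \<omega>) p"
  obtains h where "integrable M h" "AE \<omega> in M. fiber_min f \<pi> (W \<omega>) x = ereal (h \<omega>)"
proof -
  interpret prob_space M by (rule M)
  define \<G> where "\<G> = {G \<in> \<P>. x \<in> \<pi> ` G}"
  have \<G>: "finite \<G>" "\<G> \<noteq> {}"
    using sub x unfolding \<G>_def affine_subdivision_def by (simp, blast)
  have "\<exists>p r. p \<in> G \<and> \<pi> p = x \<and> f p = ereal r" if G: "G \<in> \<G>" for G
  proof -
    obtain p where "p \<in> G" "\<pi> p = x" using G by (auto simp: \<G>_def)
    moreover have "G \<in> \<P>" using G by (simp add: \<G>_def)
    ultimately show ?thesis using affine_subdivision_cell[OF sub] by metis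
  qed
  then obtain p r where p: "\<And>G. G \<in> \<G> \<Longrightarrow> p G \<in> G" "\<And>G. G \<in> \<G> \<Longrightarrow> \<pi> (p G) = x"
    "\<And>G. G \<in> \<G> \<Longrightarrow> f (p G) = ereal (r G)"
    by metis
  define h where "h \<omega> = (MIN G\<in>\<G>. W \<omega> \<bullet> p G + r G)" for \<omega>
  have "integrable M h"
    unfolding h_def using \<G> W by (intro integrable_MIN) auto
  moreover have "AE \<omega> in M. fiber_min f \<pi> (W \<omega>) x = ereal (h \<omega>)"
    using att
  proof eventually_elim
    case (elim \<omega>)
    obtain G where G: "G \<in> \<P>" "x \<in> \<pi> ` G"
      and opt: "\<And>q. q \<in> G \<Longrightarrow> fiber_min f \<pi> (W \<omega>) (\<pi> q) = ereal (W \<omega> \<bullet> q) + f q"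
      by (rule exists_optimal_cell[OF sub conv lin x elim]) blast
    then have G': "G \<in> \<G>" by (simp add: \<G>_def)
    have val: "fiber_min f \<pi> (W \<omega>) x = ereal (W \<omega> \<bullet> p G + r G)"
      using opt[OF p(1)[OF G']] p(2,3)[OF G'] by simp
    have "h \<omega> = W \<omega> \<bullet> p G + r G"
      unfolding h_def
    proof (rule Min_eqI)
      fix v assume "v \<in> (\<lambda>G. W \<omega> \<bullet> p G + r G) ` \<G>"
      then obtain G'' where G'': "G'' \<in> \<G>" "v = W \<omega> \<bullet> p G'' + r G''" by blast
      have "fiber_min f \<pi> (W \<omega>) x \<le> ereal v"
        using fiber_min_le[of f \<pi> "W \<omega>" "p G''"] p(2,3)[OF G''(1)] G''(2) by simp
      then show "W \<omega> \<bullet> p G + r G \<le> v" by (simp add: val)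
    qed (use \<G> G' in auto)
    then show ?case using val by simp
  qed
  ultimately show thesis by (rule that)
qed

lemma ereal_expectation_cong_AE:
  assumes "AE \<omega> in M. X \<omega> = Y \<omega>"
  shows "ereal_expectation M X = ereal_expectation M Y"
proof -
  have "(\<integral>\<^sup>+\<omega>. e2ennreal (X \<omega>) \<partial>M) = (\<integral>\<^sup>+\<omega>. e2ennreal (Y \<omega>) \<partial>M)"
    "(\<integral>\<^sup>+\<omega>. e2ennreal (- X \<omega>) \<partial>M) = (\<integral>\<^sup>+\<omega>. e2ennreal (- Y \<omega>) \<partial>M)"
    using assms by (auto intro!: nn_integral_cong_AE)
  then show ?thesis by (simp add: ereal_expectation_def)
qed

text \<open>Affinity on a chamber and convexity hold for almost every \<open>\<omega>\<close> and pass to the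
  expectation. Polyhedrality then follows by gluing the finitely many affine pieces.\<close>

theorem expected_fiber_min_polyhedral:
  fixes \<pi> :: "'a::euclidean_space \<Rightarrow> 'c::euclidean_space" and W :: "'w \<Rightarrow> 'a"
  assumes sub: "affine_subdivision \<P> f" and conv: "convex (epi f)" and lin: "linear \<pi>"
    and M: "prob_space M" and W: "integrable M W"
    and att: "\<And>x. x \<in> \<pi> ` \<Union>\<P> \<Longrightarrow> AE \<omega> in M. \<exists>p. \<pi> p = x \<and> fiber_optimal f \<pi> (W \<omega>) p"
  defines "V \<equiv> \<lambda>x. ereal_expectation M (\<lambda>\<omega>. fiber_min f \<pi> (W \<omega>) x)"
  shows "polyhedral_fun V" and "\<forall>\<sigma>\<in>chamber_complex \<P> \<pi>. affine_fun_on \<sigma> V"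
proof -
  interpret prob_space M by (rule M)
  define X where "X = \<pi> ` \<Union>\<P>"
  have fin: "finite \<P>" and poly: "\<And>G. G \<in> \<P> \<Longrightarrow> polyhedron G" and dom: "\<Union>\<P> = {p. f p \<noteq> \<infinity>}"
    using sub by (auto simp: affine_subdivision_def)
  have "\<exists>h. integrable M h \<and> (AE \<omega> in M. fiber_min f \<pi> (W \<omega>) x = ereal (h \<omega>))" if xX: "x \<in> X" for x
  proof -
    obtain h where "integrable M h" "AE \<omega> in M. fiber_min f \<pi> (W \<omega>) x = ereal (h \<omega>)"
      by (rule fiber_min_integrable[OF sub conv lin M W _ att]) (use xX in \<open>simp_all add: X_def\<close>)
    then show ?thesis by blast
  qed
  then obtain h where h: "\<And>x. x \<in> X \<Longrightarrow> integrable M (h x)"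
    "\<And>x. x \<in> X \<Longrightarrow> AE \<omega> in M. fiber_min f \<pi> (W \<omega>) x = ereal (h x \<omega>)"
    by metis
  define g where "g x = integral\<^sup>L M (h x)" for x
  have V_eq: "V x = ereal (g x)" if "x \<in> X" for x
    unfolding V_def g_def ereal_expectation_cong_AE[OF h(2)[OF that]]
    using h(1)[OF that] by (rule ereal_expectation_integrable)
  have V_inf: "V x = \<infinity>" if x: "x \<notin> X" for x
  proof -
    have "f p = \<infinity>" if "\<pi> p = x" for p
      using x that unfolding X_def dom by blast
    then have "fiber_min f \<pi> w x = \<infinity>" for w
      unfolding fiber_min_def by (auto simp: INF_eq_iff top_ereal_def intro!: INF_eqI)
    then show ?thesis by (simp add: V_def ereal_expectation_def emeasure_space_1)
  qed
  have affine: "affine_fun_on \<sigma> V" if \<sigma>: "\<sigma> \<in> chamber_complex \<P> \<pi>" for \<sigma>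
  proof -
    obtain x0 where x0: "x0 \<in> X" "\<sigma> = chamber \<P> \<pi> x0"
      using \<sigma> unfolding chamber_complex_def X_def by blast
    have \<sigma>X: "\<sigma> \<subseteq> X"
      using \<sigma> Union_chamber_complex[of \<P> \<pi>] unfolding X_def by blast
    have c\<sigma>: "convex \<sigma>"
      unfolding x0(2) using polyhedron_chamber[OF fin poly lin] by (rule polyhedron_imp_convex)
    have "g ((1 - t) *\<^sub>R x + t *\<^sub>R y) = (1 - t) * g x + t * g y"
      if x: "x \<in> \<sigma>" and y: "y \<in> \<sigma>" and t: "0 \<le> t" "t \<le> 1" for x y t
    proof -
      define z where "z = (1 - t) *\<^sub>R x + t *\<^sub>R y"
      have z: "z \<in> \<sigma>" unfolding z_def using c\<sigma> x y t by (intro convexD) auto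
      have xX: "x \<in> X" and yX: "y \<in> X" and zX: "z \<in> X" using x y z \<sigma>X by auto
      have "AE \<omega> in M. h z \<omega> = (1 - t) * h x \<omega> + t * h y \<omega>"
        using att[OF x0(1)[unfolded X_def]] h(2)[OF xX] h(2)[OF yX] h(2)[OF zX]
      proof eventually_elim
        case (elim \<omega>)
        then show ?case
          using fiber_min_affine_on_chamber[OF sub conv lin x0(1)[unfolded X_def] elim(1)
              x[unfolded x0(2)] elim(2) y[unfolded x0(2)] elim(3) t]
          by (simp add: z_def)
      qed
      then have "g z = (\<integral>\<omega>. (1 - t) * h x \<omega> + t * h y \<omega> \<partial>M)"
        unfolding g_def using h(1)[OF xX] h(1)[OF yX] h(1)[OF zX]
        by (intro integral_cong_AE) auto
      also have "\<dots> = (1 - t) * g x + t * g y"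
        unfolding g_def using h(1)[OF xX] h(1)[OF yX] by simp
      finally show ?thesis unfolding z_def .
    qed
    then obtain a \<beta> where "\<And>x. x \<in> \<sigma> \<Longrightarrow> g x = a \<bullet> x + \<beta>"
      using affine_extension[OF c\<sigma>, of g] by blast
    then have "\<forall>x\<in>\<sigma>. V x = ereal (a \<bullet> x + \<beta>)" using V_eq \<sigma>X by auto
    then show ?thesis unfolding affine_fun_on_def by blast
  qed
  then show "\<forall>\<sigma>\<in>chamber_complex \<P> \<pi>. affine_fun_on \<sigma> V" by blast
  have "convex (epi V)"
    unfolding convex_alt
  proof (intro ballI allI impI)
    fix p q t assume p: "p \<in> epi V" and q: "q \<in> epi V" and t: "0 \<le> t \<and> t \<le> (1::real)"
    obtain x r where pr: "p = (x, r)" by (cases p)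
    obtain y s where qs: "q = (y, s)" by (cases q)
    have Vx: "V x \<le> ereal r" and Vy: "V y \<le> ereal s"
      using p q by (simp_all add: pr qs epi_def)
    have xX: "x \<in> X" and yX: "y \<in> X" using Vx Vy V_inf by force+
    define z where "z = (1 - t) *\<^sub>R x + t *\<^sub>R y"
    have "convex X"
    proof -
      have "\<Union>\<P> = fst ` epi f"
      proof (intro equalityI subsetI)
        fix p assume "p \<in> \<Union>\<P>"
        then obtain u where "f p = ereal u"
          using affine_subdivision_finite_value[OF sub, of p] unfolding dom by auto
        then have "(p, u) \<in> epi f" by (simp add: epi_def)
        then show "p \<in> fst ` epi f" by force
      qed (auto simp: dom epi_def)
      then show ?thesis
        unfolding X_def using conv lin by (simp add: convex_linear_image linear_fst)
    qed
    then have zX: "z \<in> X" unfolding z_def using xX yX t by (intro convexD) auto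
    have "AE \<omega> in M. h z \<omega> \<le> (1 - t) * h x \<omega> + t * h y \<omega>"
      using att[OF xX[unfolded X_def]] att[OF yX[unfolded X_def]]
        h(2)[OF xX] h(2)[OF yX] h(2)[OF zX]
    proof eventually_elim
      case (elim \<omega>)
      then show ?case
        using fiber_min_convex_combination[OF conv lin elim(1,3,2,4), of t] t
        by (simp add: z_def)
    qed
    then have "g z \<le> (\<integral>\<omega>. (1 - t) * h x \<omega> + t * h y \<omega> \<partial>M)"
      unfolding g_def using h(1)[OF xX] h(1)[OF yX] h(1)[OF zX]
      by (intro integral_mono_AE) auto
    also have "\<dots> = (1 - t) * g x + t * g y"
      unfolding g_def using h(1)[OF xX] h(1)[OF yX] by simp
    also have "\<dots> \<le> (1 - t) * r + t * s"
      using Vx Vy V_eq[OF xX] V_eq[OF yX] t by (intro add_mono mult_left_mono) auto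
    finally show "(1 - t) *\<^sub>R p + t *\<^sub>R q \<in> epi V"
      using V_eq[OF zX] by (simp add: pr qs epi_def z_def)
  qed
  then show "polyhedral_fun V"
  proof (rule polyhedral_fun_glue[rotated -1])
    show "finite (chamber_complex \<P> \<pi>)" using fin by (rule finite_chamber_complex)
    show "polyhedron \<sigma>" if "\<sigma> \<in> chamber_complex \<P> \<pi>" for \<sigma>
      using that polyhedron_chamber[OF fin poly lin] unfolding chamber_complex_def by blast
    show "V x = \<infinity>" if "x \<notin> \<Union>(chamber_complex \<P> \<pi>)" for x
      using that V_inf unfolding Union_chamber_complex X_def by blast
  qed (rule affine)
qed

section \<open>Two-stage stochastic programs with a random cost\<close>

lemma polyhedron_matrix_inequality:
  fixes A :: "real^'m^'q" and B :: "real^'n^'q" and b :: "real^'q"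
  shows "polyhedron {(x, y). A *v y + B *v x \<le> b}"
proof -
  have "{(x, y). A *v y + B *v x \<le> b} = (\<Inter>i. {p. (B $ i, A $ i) \<bullet> p \<le> b $ i})"
    by (auto simp: less_eq_vec_def matrix_vector_mul_component add.commute)
  also have "polyhedron \<dots>"
    by (intro polyhedron_Inter) (auto simp: polyhedron_halfspace_le)
  finally show ?thesis .
qed

theorem lemma15:
  fixes R :: "real^'m \<Rightarrow> ereal"
    and A :: "real^'m^'q" and B :: "real^'n^'q" and b :: "real^'q"
    and M :: "'w measure" and c :: "'w \<Rightarrow> real^'m"
    and \<R> :: "(real^'m) set set"
    and Q :: "(real^'n) \<times> (real^'m) \<Rightarrow> ereal" and V :: "real^'n \<Rightarrow> ereal"
    and P :: "((real^'n) \<times> (real^'m)) set" and \<V> :: "(real^'n) set set"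
  assumes "polyhedral_fun R"
    and "prob_space M"
    and "integrable M c"
    and "AE \<omega> in M. c \<omega> \<in> uminus ` Cone (transpose A)"
  defines "\<R> \<equiv> (\<lambda>F. fst ` F) ` lower_faces (epi R)"
    and "Q \<equiv> \<lambda>(x, y). R y + indicator_inf (A *v y + B *v x \<le> b)"
    and "V \<equiv> \<lambda>x. ereal_expectation M (\<lambda>\<omega>. INF y. ereal (c \<omega> \<bullet> y) + Q (x, y))"
    and "P \<equiv> {(x, y). A *v y + B *v x \<le> b}"
    and "\<V> \<equiv> chamber_complex (faces P \<and>\<^sub>r ((\<lambda>\<sigma>. UNIV \<times> \<sigma>) ` \<R>)) fst"
  shows "\<V> \<preceq>\<^sub>r chamber_complex (faces (epi Q)) (\<lambda>((x, y), z). x) \<and>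
    ((\<forall>x. AE \<omega> in M. \<exists>y. is_arg_min (\<lambda>y. ereal (c \<omega> \<bullet> y) + Q (x, y)) (\<lambda>_. True) y) \<longrightarrow>
      polyhedral_fun V \<and> (\<forall>\<sigma>\<in>\<V>. affine_fun_on \<sigma> V))"
proof -
  have "polyhedron P"
    unfolding P_def by (rule polyhedron_matrix_inequality)
  define \<P> where "\<P> = faces P \<and>\<^sub>r ((\<lambda>\<sigma>. UNIV \<times> \<sigma>) ` \<R>)"
  have Q_eq: "Q = (\<lambda>(x, y). R y + indicator_inf ((x, y) \<in> P))"
    by (auto simp: Q_def P_def)
  have sub: "affine_subdivision \<P> Q"
    unfolding \<P>_def Q_eq \<R>_def
    using affine_subdivision_lower_faces[OF assms(1)] \<open>polyhedron P\<close>
    by (rule affine_subdivision_constraint)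
  have "epi Q = (\<lambda>((x, y), z). (y, z)) -` epi R \<inter> (fst -` P)"
    by (auto simp: Q_eq epi_def indicator_inf_def split: if_splits)
  moreover have "linear (\<lambda>((x :: real^'n, y :: real^'m), z :: real). (y, z))"
    by (intro linearI) (auto simp: case_prod_beta)
  moreover have "polyhedron (epi R)"
    using assms(1) by (simp add: polyhedral_fun_def)
  ultimately have conv: "convex (epi Q)"
    using \<open>polyhedron P\<close>
    by (simp add: convex_Int convex_linear_vimage linear_fst polyhedron_imp_convex)
  have \<V>: "\<V> = chamber_complex \<P> fst" by (simp add: \<V>_def \<P>_def)
  have "(\<lambda>((x, y), z). x) = (\<lambda>(p :: (real^'n) \<times> (real^'m), z :: real). fst p)"
    by auto
  then have "\<V> \<preceq>\<^sub>r chamber_complex (faces (epi Q)) (\<lambda>((x, y), z). x)"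
    using chamber_complex_refines_epi[OF sub conv, of fst] by (simp add: \<V>)
  moreover have "polyhedral_fun V \<and> (\<forall>\<sigma>\<in>\<V>. affine_fun_on \<sigma> V)"
    if att: "\<forall>x. AE \<omega> in M. \<exists>y. is_arg_min (\<lambda>y. ereal (c \<omega> \<bullet> y) + Q (x, y)) (\<lambda>_. True) y"
  proof -
    \<comment> \<open>The fixed component 0 makes the random objective on pairs equal to the cost of \<open>y\<close> alone.\<close>
    define W where "W \<omega> = (0 :: real^'n, c \<omega>)" for \<omega>
    have "bounded_linear (\<lambda>y :: real^'m. (0 :: real^'n, y))"
      by (intro bounded_linear_Pair bounded_linear_zero bounded_linear_ident)
    then have W: "integrable M W"
      unfolding W_def using assms(3) by (rule integrable_bounded_linear)
    have fiber: "{p. fst p = x} = range (Pair x)" for x :: "real^'n"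
      by (auto simp: image_iff)
    have "V = (\<lambda>x. ereal_expectation M (\<lambda>\<omega>. fiber_min Q fst (W \<omega>) x))"
      unfolding V_def fiber_min_def fiber by (simp add: W_def image_image)
    moreover have "AE \<omega> in M. \<exists>p. fst p = x \<and> fiber_optimal Q fst (W \<omega>) p" for x
      using att[rule_format, of x]
    proof eventually_elim
      case (elim \<omega>)
      then obtain y where "is_arg_min (\<lambda>y. ereal (c \<omega> \<bullet> y) + Q (x, y)) (\<lambda>_. True) y" by blast
      then have "fiber_optimal Q fst (W \<omega>) (x, y)"
        by (auto simp: fiber_optimal_def is_arg_min_def W_def not_less)
      then show ?case by force
    qed
    ultimately show ?thesis
      using expected_fiber_min_polyhedral[OF sub conv linear_fst assms(2) W] by (simp add: \<V>)
  qed
  ultimately show ?thesis by blast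
qed

end
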